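(* For every integer $k \geq 0$, \[ K(2^k) \;\geq\; 2^{-k/2} + \sum_{a=1}^{k} 2^{-a/2}. \] Consequently, $K \geq \sum_{a=1}^{\infty} 2^{-a/2} = 1 + \sqrt{2} \approx 2.414$.
   Context: For a real matrix $\bm A \in \mathbb{R}^{m\times n}$, its discrepancy is $\Delta(\bm A) = \min_{\bm x \in \{\pm 1\}^n} \|\bm A \bm x\|_\infty$. Define \[ K(n) = \max\{\Delta(\bm A) : \bm A \in \mathbb{R}^{n\times n},\ \text{every column of } \bm A \text{ has } \ell^2 \text{ norm at most } 1\}, \] and $K = \sup_{n \geq 1} K(n)$ (the constant in the Komlós conjecture). *)

theory Defs
  imports
    "Jordan_Normal_Form.Matrix"
    "HOL-Analysis.Function_Topology"
    "HOL-Library.Extended_Real"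
begin

definition l2_norm :: "real vec \<Rightarrow> real" where
  "l2_norm v = sqrt (\<Sum>i<dim_vec v. (v $ i)\<^sup>2)"

(* Inserting 0 changes nothing unless the vector is empty, whose norm is then 0. *)
definition linf_norm :: "real vec \<Rightarrow> real" where
  "linf_norm v = Max (insert 0 ((\<lambda>i. \<bar>v $ i\<bar>) ` {..<dim_vec v}))"

definition sign_vecs :: "nat \<Rightarrow> real vec set" where
  "sign_vecs n = {x \<in> carrier_vec n. \<forall>i<n. x $ i \<in> {- 1, 1}}"

definition discrepancy :: "real mat \<Rightarrow> real" where
  "discrepancy A = Min ((\<lambda>x. linf_norm (A *\<^sub>v x)) ` sign_vecs (dim_col A))"

definition komlos_mats :: "nat \<Rightarrow> real mat set" where
  "komlos_mats n = {A \<in> carrier_mat n n. \<forall>j<n. l2_norm (col A j) \<le> 1}"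

(* The supremum is a maximum: see komlos_number_attained below. *)
definition komlos_number :: "nat \<Rightarrow> real" where
  "komlos_number n = Sup (discrepancy ` komlos_mats n)"

(* Extended-real valued, as finiteness of this supremum is the Komlos conjecture. *)
definition komlos_constant :: ereal where
  "komlos_constant = (SUP n\<in>{1..}. ereal (komlos_number n))"

lemma finite_sign_vecs: "finite (sign_vecs n)"
proof (rule finite_subset)
  show "sign_vecs n \<subseteq> vec_of_list ` {xs. set xs \<subseteq> {- 1, 1} \<and> length xs = n}"
  proof
    fix x assume x: "x \<in> sign_vecs n"
    have "set (list_of_vec x) \<subseteq> {- 1, 1}" "length (list_of_vec x) = n"
      using x by (auto simp: sign_vecs_def set_list_of_vec vec_set_def)
    then show "x \<in> vec_of_list ` {xs. set xs \<subseteq> {- 1, 1} \<and> length xs = n}"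
      by (intro image_eqI[of _ _ "list_of_vec x"]) (auto simp: vec_list)
  qed
qed (intro finite_imageI finite_lists_length_eq, simp)

lemma sign_vecs_nonempty: "sign_vecs n \<noteq> {}"
proof -
  have "vec n (\<lambda>_. 1) \<in> sign_vecs n" by (simp add: sign_vecs_def)
  then show ?thesis by blast
qed

lemma continuous_on_Min_image:
  fixes g :: "'a \<Rightarrow> 'b::topological_space \<Rightarrow> real"
  assumes "finite X" "X \<noteq> {}" "\<And>x. x \<in> X \<Longrightarrow> continuous_on S (g x)"
  shows "continuous_on S (\<lambda>f. Min ((\<lambda>x. g x f) ` X))"
  using assms
proof (induction X rule: finite_ne_induct)
  case (insert x X)
  then have "continuous_on S (\<lambda>f. min (g x f) (Min ((\<lambda>x. g x f) ` X)))"
    by (intro continuous_on_min) auto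
  with insert show ?case by simp
qed simp

lemma continuous_on_Max_image:
  fixes g :: "'a \<Rightarrow> 'b::topological_space \<Rightarrow> real"
  assumes "finite X" "\<And>x. x \<in> X \<Longrightarrow> continuous_on S (g x)"
  shows "continuous_on S (\<lambda>f. Max (insert 0 ((\<lambda>x. g x f) ` X)))"
  using assms
proof (induction X rule: finite_induct)
  case (insert x X)
  then have "continuous_on S (\<lambda>f. max (g x f) (Max (insert 0 ((\<lambda>x. g x f) ` X))))"
    by (intro continuous_on_max) auto
  moreover have "Max (insert 0 ((\<lambda>x. g x f) ` insert x X))
      = max (g x f) (Max (insert 0 ((\<lambda>x. g x f) ` X)))" for f
    using insert.hyps by (subst Max_insert[symmetric]) (auto simp: insert_commute)
  ultimately show ?case by simp
qed simp

lemma continuous_on_entry: "continuous_on S (\<lambda>f :: nat \<times> nat \<Rightarrow> real. f p)"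
  by (rule continuous_on_product_coordinates[THEN continuous_on_subset]) simp

lemma komlos_number_attained:
  "\<exists>A \<in> komlos_mats n. discrepancy A = komlos_number n \<and>
     (\<forall>B \<in> komlos_mats n. discrepancy B \<le> discrepancy A)"
proof -
  let ?I = "{..<n} \<times> {..<n}"
  define S :: "(nat \<times> nat \<Rightarrow> real) set"
    where "S = Pi\<^sub>E UNIV (\<lambda>p. if p \<in> ?I then {- 1..1} else {0})"
  define T where "T = {f. \<forall>j<n. (\<Sum>i<n. (f (i, j))\<^sup>2) \<le> (1 :: real)}"
  define d where "d = (\<lambda>f. discrepancy (mat n n f))"
  have "compact S"
  proof -
    have "compactin (product_topology (\<lambda>_. euclidean) UNIV) S"
      unfolding S_def by (subst compactin_PiE) (auto simp: compact_Icc)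
    then show ?thesis by (simp add: euclidean_product_topology)
  qed
  moreover have "closed T"
    unfolding T_def
    by (intro closed_Collect_all closed_Collect_imp closed_Collect_le continuous_intros
        continuous_on_entry) auto
  ultimately have "compact (S \<inter> T)" by (rule compact_Int_closed)
  moreover have "(\<lambda>_. 0) \<in> S \<inter> T" by (auto simp: S_def T_def)
  moreover have "continuous_on (S \<inter> T) d"
  proof -
    have *: "linf_norm (mat n n f *\<^sub>v x)
        = Max (insert 0 ((\<lambda>i. \<bar>\<Sum>j<n. f (i, j) * x $ j\<bar>) ` {..<n}))"
      if "x \<in> sign_vecs n" for f x
      unfolding linf_norm_def
      using that by (intro arg_cong[where f = "\<lambda>X. Max (insert 0 X)"] image_cong)
        (auto simp: sign_vecs_def scalar_prod_def atLeast0LessThan)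
    have "d = (\<lambda>f. Min ((\<lambda>x. Max (insert 0 ((\<lambda>i. \<bar>\<Sum>j<n. f (i, j) * x $ j\<bar>) ` {..<n})))
        ` sign_vecs n))"
      unfolding d_def discrepancy_def
      using * by (intro ext arg_cong[where f = Min] image_cong) auto
    then show ?thesis
      by (simp only:) (intro continuous_on_Min_image continuous_on_Max_image continuous_intros
          continuous_on_entry finite_sign_vecs sign_vecs_nonempty finite_lessThan)
  qed
  ultimately obtain f where f: "f \<in> S \<inter> T" "\<And>g. g \<in> S \<inter> T \<Longrightarrow> d g \<le> d f"
    using continuous_attains_sup[of "S \<inter> T" d] by blast
  have norm_col: "l2_norm (col A j) \<le> 1 \<longleftrightarrow> (\<Sum>i<n. (A $$ (i, j))\<^sup>2) \<le> 1"
    if "A \<in> carrier_mat n n" "j < n" for A j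
    using that by (auto simp: l2_norm_def)
  have A: "mat n n f \<in> komlos_mats n"
    using f(1) by (simp add: komlos_mats_def T_def l2_norm_def)
  have max: "discrepancy B \<le> discrepancy (mat n n f)" if B: "B \<in> komlos_mats n" for B
  proof -
    define g where "g = (\<lambda>p. if p \<in> ?I then B $$ p else 0)"
    have carr: "B \<in> carrier_mat n n" using B by (simp add: komlos_mats_def)
    have eq: "mat n n g = B" using carr by (intro eq_matI) (auto simp: g_def)
    have sq: "(\<Sum>i<n. (B $$ (i, j))\<^sup>2) \<le> 1" if "j < n" for j
      using B that norm_col[OF carr that] by (simp add: komlos_mats_def)
    have "\<bar>B $$ (i, j)\<bar> \<le> 1" if "i < n" "j < n" for i j
    proof -
      have "(B $$ (i, j))\<^sup>2 \<le> (\<Sum>i<n. (B $$ (i, j))\<^sup>2)"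
        using that by (intro member_le_sum) auto
      with sq[OF that(2)] have "(B $$ (i, j))\<^sup>2 \<le> 1" by linarith
      then show ?thesis by (simp add: abs_square_le_1)
    qed
    then have "g \<in> S" by (auto simp: S_def g_def abs_le_iff minus_le_iff)
    moreover have "g \<in> T" using sq by (simp add: T_def g_def)
    ultimately show ?thesis using f(2)[of g] by (simp add: d_def eq)
  qed
  have "discrepancy (mat n n f) = komlos_number n"
    unfolding komlos_number_def using A max by (intro cSup_eq_maximum[symmetric]) auto
  with A max show ?thesis by auto
qed

end

(*
  The extremal matrix is the 2^k-dimensional Haar matrix. Its rows are the leaves of the complete
  binary tree of depth k, and its columns are the inner nodes together with one constant column.
  An inner node of height a has 2^a leaves below it; its column is 2^(-a/2) on the left ones and
  -2^(-a/2) on the right ones. Read a sign vector as a sign on each inner node and a sign s on the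
  constant column. Descending from the root, always into the child on which the node contributes
  with sign s, leads to a row whose entries all contribute with the same sign, so that nothing
  cancels.
*)
theory Submission
  imports Defs
begin

section \<open>Bounding the discrepancy from below\<close>

lemma abs_le_linf_norm: "i < dim_vec v \<Longrightarrow> \<bar>v $ i\<bar> \<le> linf_norm v"
  by (auto simp: linf_norm_def intro!: Max_ge)

lemma discrepancy_geI:
  assumes "\<And>x. x \<in> sign_vecs (dim_col A) \<Longrightarrow> \<exists>i<dim_row A. c \<le> \<bar>row A i \<bullet> x\<bar>"
  shows "c \<le> discrepancy A"
proof -
  have "c \<le> linf_norm (A *\<^sub>v x)" if x: "x \<in> sign_vecs (dim_col A)" for x
  proof -
    obtain i where i: "i < dim_row A" "c \<le> \<bar>row A i \<bullet> x\<bar>" using assms[OF x] by blast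
    then show ?thesis using abs_le_linf_norm[of i "A *\<^sub>v x"] by simp
  qed
  then show ?thesis
    unfolding discrepancy_def by (subst Min_ge_iff) (auto simp: finite_sign_vecs sign_vecs_nonempty)
qed

lemma discrepancy_le_komlos_number: "A \<in> komlos_mats n \<Longrightarrow> discrepancy A \<le> komlos_number n"
  using komlos_number_attained[of n] by auto

text \<open>Nodes are numbered as in a binary heap: the root is 1, the children of \<open>m\<close> are \<open>2 * m\<close> and
  \<open>2 * m + 1\<close>, and the leaves are \<open>2 ^ k, \<dots>, 2 ^ (k + 1) - 1\<close>. So the ancestor of height \<open>a\<close> of
  a leaf \<open>m\<close> is \<open>m div 2 ^ a\<close>, and column 0 is left for the constant one.\<close>

definition child_sign :: "nat \<Rightarrow> real" where
  "child_sign m = (if even m then 1 else - 1)"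

definition haar_weight :: "nat \<Rightarrow> real" where
  "haar_weight a = 2 powr (- real a / 2)"

text \<open>Here \<open>m\<close> is the heap number of a leaf. For such \<open>m\<close> at most
  one summand is nonzero. Summing over heights makes a row sum a matter of exchanging two
  sums.\<close>

definition haar_entry :: "nat \<Rightarrow> nat \<Rightarrow> nat \<Rightarrow> real" where
  "haar_entry k m j = (if j = 0 then haar_weight k else 0)
     + (\<Sum>a = 1..k. if m div 2 ^ a = j then haar_weight a * child_sign (m div 2 ^ (a - 1)) else 0)"

definition haar_mat :: "nat \<Rightarrow> real mat" where
  "haar_mat k = mat (2 ^ k) (2 ^ k) (\<lambda>(i, j). haar_entry k (2 ^ k + i) j)"

lemma child_sign_square [simp]: "(child_sign m)\<^sup>2 = 1"
  by (simp add: child_sign_def)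

lemma haar_weight_nonneg [simp]: "0 \<le> haar_weight a"
  by (simp add: haar_weight_def)

lemma haar_weight_square: "(haar_weight a)\<^sup>2 = 1 / 2 ^ a"
proof -
  have "(haar_weight a)\<^sup>2 = 2 powr (- real a)"
    by (simp add: haar_weight_def power2_eq_square flip: powr_add)
  then show ?thesis by (simp add: powr_minus powr_realpow divide_inverse)
qed

section \<open>Levels and paths of the binary tree\<close>

lemma ancestor_bounds:
  fixes m :: nat
  assumes "2 ^ k \<le> m" "m < 2 ^ Suc k" "a \<le> k"
  shows "2 ^ (k - a) \<le> m div 2 ^ a" "m div 2 ^ a < 2 ^ Suc (k - a)"
proof -
  have eq: "2 ^ k = 2 ^ (k - a) * (2 ^ a :: nat)" using assms(3) by (simp flip: power_add)
  show "2 ^ (k - a) \<le> m div 2 ^ a"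
    using assms(1) eq by (simp add: less_eq_div_iff_mult_less_eq)
  show "m div 2 ^ a < 2 ^ Suc (k - a)"
    using assms(2) eq by (simp add: div_less_iff_less_mult)
qed

text \<open>The nodes of height \<open>a\<close> fill the dyadic interval from
  \<open>2 ^ (k - a)\<close> to \<open>2 ^ Suc (k - a)\<close>, and these intervals are
  disjoint.\<close>

lemma ancestor_height_unique:
  fixes m m' :: nat
  assumes m: "2 ^ k \<le> m" "m < 2 ^ Suc k" "a \<le> k"
    and m': "2 ^ k \<le> m'" "m' < 2 ^ Suc k" "b \<le> k"
    and eq: "m div 2 ^ a = m' div 2 ^ b"
  shows "a = b"
proof -
  have "(2::nat) ^ (k - a) < 2 ^ Suc (k - b)" "(2::nat) ^ (k - b) < 2 ^ Suc (k - a)"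
    using ancestor_bounds[OF m] ancestor_bounds[OF m'] eq by linarith+
  then have "k - a < Suc (k - b)" "k - b < Suc (k - a)"
    by (simp_all only: power_strict_increasing_iff one_less_numeral_iff semiring_norm)
  with m(3) m'(3) show ?thesis by linarith
qed

text \<open>Induction on the depth: a good leaf becomes an inner node, and the path is extended to
  one of its two children.\<close>

lemma ex_monochromatic_leaf:
  fixes x :: "nat \<Rightarrow> real"
  assumes "\<And>j. j < 2 ^ k \<Longrightarrow> x j \<in> {- 1, 1}" and s: "s \<in> {- 1, 1}"
  shows "\<exists>m. 2 ^ k \<le> m \<and> m < 2 ^ Suc k \<and>
     (\<forall>a\<in>{1..k}. child_sign (m div 2 ^ (a - 1)) * x (m div 2 ^ a) = s)"
  using assms(1)
proof (induction k)
  case 0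
  show ?case by (intro exI[of _ 1]) auto
next
  case (Suc k)
  have "x j \<in> {- 1, 1}" if "j < 2 ^ k" for j
    using that by (intro Suc.prems) simp
  from Suc.IH[OF this] obtain m where m: "2 ^ k \<le> m" "m < 2 ^ Suc k"
    and mono: "\<And>a. a \<in> {1..k} \<Longrightarrow> child_sign (m div 2 ^ (a - 1)) * x (m div 2 ^ a) = s"
    by auto
  \<comment> \<open>If \<open>x m = s\<close>, the even child, of sign 1, is right; otherwise
    \<open>x m = -s\<close>, and the odd child flips the sign.\<close>
  define m' where "m' = 2 * m + (if x m = s then 0 else 1)"
  have half: "m' div 2 = m" by (simp add: m'_def)
  have anc: "m' div 2 ^ Suc b = m div 2 ^ b" for b
    by (simp add: div_mult2_eq half)
  have "child_sign m' * x m = s"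
    using Suc.prems[OF m(2)] s by (auto simp: m'_def child_sign_def)
  moreover have "child_sign (m' div 2 ^ b) * x (m' div 2 ^ Suc b) = s" if "b \<in> {1..k}" for b
    using mono[OF that] anc[of b] anc[of "b - 1"] that by (cases b) auto
  ultimately have "child_sign (m' div 2 ^ b) * x (m' div 2 ^ Suc b) = s" if "b \<le> k" for b
    using that half by (cases "b = 0") auto
  then have "child_sign (m' div 2 ^ (a - 1)) * x (m' div 2 ^ a) = s" if "a \<in> {1..Suc k}" for a
    using that by (cases a) auto
  moreover have "2 ^ Suc k \<le> m'" "m' < 2 ^ Suc (Suc k)"
    using m by (auto simp: m'_def)
  ultimately show ?case by blast
qed

section \<open>Entries and column norms\<close>

lemma haar_entry_constant_column:
  assumes "2 ^ k \<le> m" "m < 2 ^ Suc k"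
  shows "haar_entry k m 0 = haar_weight k"
proof -
  have nz: "m div 2 ^ a \<noteq> 0" if "a \<le> k" for a
    using ancestor_bounds(1)[OF assms that] by (metis not_le zero_less_numeral zero_less_power)
  show ?thesis by (simp add: haar_entry_def nz)
qed

text \<open>The leaf \<open>m0\<close> certifies that \<open>j\<close> has height \<open>a\<close>,
  so by uniqueness of heights only the summand for \<open>a\<close> can survive.\<close>

lemma haar_entry_node_column:
  assumes m: "2 ^ k \<le> m" "m < 2 ^ Suc k" and a: "a \<in> {1..k}"
    and m0: "2 ^ k \<le> m0" "m0 < 2 ^ Suc k" and j: "j = m0 div 2 ^ a" "j \<noteq> 0"
  shows "haar_entry k m j
    = (if m div 2 ^ a = j then haar_weight a * child_sign (m div 2 ^ (a - 1)) else 0)"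
proof -
  have "m div 2 ^ b \<noteq> j" if "b \<in> {1..k}" "b \<noteq> a" for b
    using ancestor_height_unique[OF m _ m0, of b a] that a j by auto
  then have "haar_entry k m j
    = (\<Sum>b = 1..k. if b = a then
        (if m div 2 ^ a = j then haar_weight a * child_sign (m div 2 ^ (a - 1)) else 0) else 0)"
    unfolding haar_entry_def using j(2) by (simp only: if_False add_0) (intro sum.cong; simp)
  also have "\<dots> = (if m div 2 ^ a = j then haar_weight a * child_sign (m div 2 ^ (a - 1)) else 0)"
    using a by simp
  finally show ?thesis .
qed

lemma card_leaves_below_le: "card {i\<in>{..<n}. (l + i) div 2 ^ a = j} \<le> 2 ^ a" for n l j :: nat
proof -
  have "(\<lambda>i. l + i) ` {i\<in>{..<n}. (l + i) div 2 ^ a = j} \<subseteq> {j * 2 ^ a..<j * 2 ^ a + 2 ^ a}"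
    using dividend_less_div_times[of "2 ^ a"] by (auto simp: add.commute)
  from card_mono[OF _ this] show ?thesis by (simp add: card_image)
qed

text \<open>A node of height \<open>a\<close> has at most \<open>2 ^ a\<close> leaves below it, each
  contributing \<open>1 / 2 ^ a\<close>.\<close>

lemma haar_entry_column_norm: "(\<Sum>i<2 ^ k. (haar_entry k (2 ^ k + i) j)\<^sup>2) \<le> 1"
proof -
  consider "j = 0"
    | a i0 where "j \<noteq> 0" "a \<in> {1..k}" "i0 < 2 ^ k" "j = (2 ^ k + i0) div 2 ^ a"
    \<comment> \<open>Treating a column above no leaf as zero avoids showing that each inner node
      has a leaf below it.\<close>
    | "j \<noteq> 0" "\<And>a i. a \<in> {1..k} \<Longrightarrow> i < 2 ^ k \<Longrightarrow> (2 ^ k + i) div 2 ^ a \<noteq> j"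
    by blast
  then show ?thesis
  proof cases
    case 1
    then show ?thesis by (simp add: haar_entry_constant_column haar_weight_square)
  next
    case (2 a i0)
    have "(haar_entry k (2 ^ k + i) j)\<^sup>2 = (if (2 ^ k + i) div 2 ^ a = j then 1 / 2 ^ a else 0)"
      if "i < 2 ^ k" for i
      using haar_entry_node_column[of k "2 ^ k + i" a "2 ^ k + i0" j] 2 that
      by (simp add: power_mult_distrib haar_weight_square)
    then have "(\<Sum>i<2 ^ k. (haar_entry k (2 ^ k + i) j)\<^sup>2)
      = (\<Sum>i<2 ^ k. if (2 ^ k + i) div 2 ^ a = j then 1 / 2 ^ a else 0)"
      by (intro sum.cong) auto
    also have "\<dots> = card {i\<in>{..<2 ^ k}. (2 ^ k + i) div 2 ^ a = j} / 2 ^ a"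
      by (simp flip: sum.inter_filter)
    also have "\<dots> \<le> 1"
      using card_leaves_below_le[of "2 ^ k" "2 ^ k" a j, folded of_nat_le_iff[where ?'a = real]]
      by simp
    finally show ?thesis .
  next
    case 3
    then have "haar_entry k (2 ^ k + i) j = 0" if "i < 2 ^ k" for i
      using that by (auto simp: haar_entry_def intro!: sum.neutral)
    then show ?thesis by simp
  qed
qed

lemma haar_mat_in_komlos_mats: "haar_mat k \<in> komlos_mats (2 ^ k)"
  using haar_entry_column_norm by (simp add: komlos_mats_def haar_mat_def l2_norm_def)

section \<open>Row sums and discrepancy\<close>

lemma haar_entry_row_sum:
  assumes "2 ^ k \<le> m" "m < 2 ^ Suc k"
  shows "(\<Sum>j<2 ^ k. haar_entry k m j * x j) = haar_weight k * x 0
    + (\<Sum>a = 1..k. haar_weight a * (child_sign (m div 2 ^ (a - 1)) * x (m div 2 ^ a)))"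
proof -
  have lt: "m div 2 ^ a < 2 ^ k" if "a \<in> {1..k}" for a
  proof -
    have "m div 2 ^ a < 2 ^ Suc (k - a)" using ancestor_bounds(2)[OF assms, of a] that by simp
    also have "\<dots> \<le> 2 ^ k" using that by (intro power_increasing) auto
    finally show ?thesis .
  qed
  have "(\<Sum>j<2 ^ k. haar_entry k m j * x j)
    = (\<Sum>j::nat<2 ^ k. if j = 0 then haar_weight k * x 0 else 0)
    + (\<Sum>j<2 ^ k. \<Sum>a = 1..k. if j = m div 2 ^ a
        then haar_weight a * (child_sign (m div 2 ^ (a - 1)) * x (m div 2 ^ a)) else 0)"
    unfolding haar_entry_def distrib_right sum.distrib sum_distrib_right
    by (intro arg_cong2[where f = "(+)"] sum.cong) auto
  also have "(\<Sum>j<2 ^ k. \<Sum>a = 1..k. if j = m div 2 ^ a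
        then haar_weight a * (child_sign (m div 2 ^ (a - 1)) * x (m div 2 ^ a)) else 0)
    = (\<Sum>a = 1..k. haar_weight a * (child_sign (m div 2 ^ (a - 1)) * x (m div 2 ^ a)))"
    \<comment> \<open>By \<open>lt\<close> every ancestor of \<open>m\<close> is a column index, so
      each inner sum picks out exactly one \<open>j\<close>.\<close>
    using lt by (subst sum.swap) (auto intro!: sum.cong)
  finally show ?thesis by simp
qed

lemma discrepancy_haar_mat_ge:
  "haar_weight k + (\<Sum>a = 1..k. haar_weight a) \<le> discrepancy (haar_mat k)"
proof (rule discrepancy_geI)
  fix x assume "x \<in> sign_vecs (dim_col (haar_mat k))"
  then have x: "dim_vec x = 2 ^ k" "\<And>j. j < 2 ^ k \<Longrightarrow> x $ j \<in> {- 1, 1}"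
    by (auto simp: sign_vecs_def haar_mat_def)
  have x0: "x $ 0 \<in> {- 1, 1}" using x(2)[of 0] by simp
  \<comment> \<open>The target sign is \<open>x $ 0\<close>, so that the tree terms agree with the
    constant column.\<close>
  obtain m where m: "2 ^ k \<le> m" "m < 2 ^ Suc k"
    and mono: "\<And>a. a \<in> {1..k} \<Longrightarrow> child_sign (m div 2 ^ (a - 1)) * x $ (m div 2 ^ a) = x $ 0"
    using ex_monochromatic_leaf[of k "vec_index x", OF x(2) x0] by auto
  have i: "m - 2 ^ k < 2 ^ k" using m by simp
  have "row (haar_mat k) (m - 2 ^ k) \<bullet> x = (\<Sum>j<2 ^ k. haar_entry k m j * x $ j)"
    using x(1) m i by (simp add: scalar_prod_def haar_mat_def atLeast0LessThan)
  also have "\<dots> = (haar_weight k + (\<Sum>a = 1..k. haar_weight a)) * x $ 0"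
    using mono by (simp add: haar_entry_row_sum[OF m] distrib_right sum_distrib_right)
  finally have "\<bar>row (haar_mat k) (m - 2 ^ k) \<bullet> x\<bar>
      = haar_weight k + (\<Sum>a = 1..k. haar_weight a)"
    using x0 by (auto simp: abs_mult add_nonneg_nonneg sum_nonneg)
  then show "\<exists>i<dim_row (haar_mat k).
      haar_weight k + (\<Sum>a = 1..k. haar_weight a) \<le> \<bar>row (haar_mat k) i \<bullet> x\<bar>"
    using i by (intro exI[of _ "m - 2 ^ k"]) (simp add: haar_mat_def)
qed

lemma komlos_number_power_two_ge:
  "haar_weight k + (\<Sum>a = 1..k. haar_weight a) \<le> komlos_number (2 ^ k)"
  using discrepancy_haar_mat_ge discrepancy_le_komlos_number[OF haar_mat_in_komlos_mats]
  by (rule order_trans)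

section \<open>The geometric series and the limit in \<open>k\<close>\<close>

lemma haar_weight_sums: "(\<lambda>a. haar_weight (Suc a)) sums (1 + sqrt 2)"
proof -
  have *: "haar_weight a = (1 / sqrt 2) ^ a" for a
  proof (rule power2_eq_imp_eq)
    show "(haar_weight a)\<^sup>2 = ((1 / sqrt 2) ^ a)\<^sup>2"
      by (simp add: haar_weight_square power_divide flip: power_mult real_sqrt_power)
        (simp add: power_mult mult.commute[of a] real_sqrt_power)
  qed auto
  have lt: "norm (1 / sqrt 2) < 1" by simp
  have ne: "sqrt 2 \<noteq> 1" "sqrt 2 - 1 \<noteq> 0" by simp_all
  have "1 / sqrt 2 * (1 / (1 - 1 / sqrt 2)) = 1 / (sqrt 2 - 1)"
    using ne by (simp add: field_simps)
  also have "\<dots> = 1 + sqrt 2"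
    using ne by (simp add: field_simps)
  finally show ?thesis
    using sums_mult[OF geometric_sums[OF lt], of "1 / sqrt 2"] by (simp add: *)
qed

lemma komlos_constant_ge: "ereal (\<Sum>a. haar_weight (Suc a)) \<le> komlos_constant"
proof (rule LIMSEQ_le_const2)
  show "(\<lambda>k. ereal (\<Sum>a<k. haar_weight (Suc a))) \<longlonglongrightarrow> ereal (\<Sum>a. haar_weight (Suc a))"
    using haar_weight_sums by (auto intro!: tendsto_intros summable_LIMSEQ sums_summable)
  have "ereal (\<Sum>a<k. haar_weight (Suc a)) \<le> komlos_constant" for k
  proof -
    have "(\<Sum>a<k. haar_weight (Suc a)) = (\<Sum>a = 1..k. haar_weight a)"
      by (rule sum.reindex_bij_witness[of _ "\<lambda>a. a - 1" Suc]) auto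
    \<comment> \<open>The extra \<open>haar_weight k\<close> tends to 0, so dropping it costs
      nothing in the limit.\<close>
    also have "\<dots> \<le> haar_weight k + (\<Sum>a = 1..k. haar_weight a)" by simp
    also have "\<dots> \<le> komlos_number (2 ^ k)" by (rule komlos_number_power_two_ge)
    finally show ?thesis
      unfolding komlos_constant_def by (intro SUP_upper2[of "2 ^ k"]) auto
  qed
  then show "\<exists>N. \<forall>k\<ge>N. ereal (\<Sum>a<k. haar_weight (Suc a)) \<le> komlos_constant" by blast
qed

theorem theorem1:
  shows "(\<forall>k::nat. komlos_number (2 ^ k)
            \<ge> 2 powr (- real k / 2) + (\<Sum>a = 1..k. 2 powr (- real a / 2)))
    \<and> komlos_constant \<ge> ereal (\<Sum>a::nat. 2 powr (- real (Suc a) / 2))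
    \<and> (\<lambda>a::nat. 2 powr (- real (Suc a) / 2)) sums (1 + sqrt 2)
    \<and> \<bar>(1 + sqrt 2) - 2.414\<bar> < 0.0005"
proof -
  \<comment> \<open>Any bounds within 1.4135 and 1.4145 would do.\<close>
  have "1.4140 < sqrt 2" "sqrt 2 < 1.4143"
    by (rule real_less_rsqrt real_less_lsqrt; simp add: power2_eq_square)+
  then have "\<bar>(1 + sqrt 2) - 2.414\<bar> < 0.0005" by (simp add: abs_if)
  then show ?thesis
    using komlos_number_power_two_ge komlos_constant_ge haar_weight_sums
    unfolding haar_weight_def by blast
qed

end
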